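(* For every $z\in\mathbb N\cup\{\infty\}$, $\mathrm{TD}(\mathrm{SR}^z,\mathrm{R}\Pi^z)=3$.
   Context: Fix a countably infinite set $X$ of variables and an alphabet $\Sigma$ (finite or countably infinite, disjoint from $X$), $z=|\Sigma|$. A pattern is a nonempty finite string over $X\cup\Sigma$; $\Pi^z$ is the class of all patterns over an alphabet of size $z$. A substitution is a morphism $h:(X\cup\Sigma)^*\to\Sigma^*$ fixing every letter; $L(\pi)=\{h(\pi)\}$ over all substitutions is the erasing pattern language. A pattern is regular if every variable occurs in it at most once; $\mathrm{R}\Pi^z$ is the class of regular patterns in $\Pi^z$. A pattern is simple block-regular if it has the shape $X_1a_1X_2\cdots a_{n-1}X_n$ with $X_i\in X^+$, $a_i\in\Sigma$, each $X_i$ containing a variable occurring in no other block; $\mathrm{SR}^z$ is the class of simple block-regular patterns in $\Pi^z$. A labelled example is $(w,+)$ or $(w,-)$ with $w\in\Sigma^*$; $\tau$ is consistent with a set $T$ of examples if $w\in L(\tau)$ for all $(w,+)\in T$ and $w\notin L(\tau)$ for all $(w,-)\in T$. A teaching set for $\pi\in\Pi$ w.r.t. a class $\Pi$ is a set $T$ consistent with $\pi$ such that every $\tau\in\Pi$ consistent with $T$ has $L(\tau)=L(\pi)$; $\mathrm{TD}(\pi,\Pi)$ is the minimum size of such a set ($\infty$ if none is finite) and $\mathrm{TD}(\Pi',\Pi)=\sup_{\pi\in\Pi'}\mathrm{TD}(\pi,\Pi)$. *)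

theory Defs
  imports Main "HOL-Library.Countable" "HOL-Library.Extended_Nat"
begin

text \<open>Symbols of a pattern: variables (indexed by nat, a countably infinite set X)
  or letters of the alphabet, which is the (nonempty, finite or countably infinite)
  universe of the type 'a.\<close>
datatype 'a sym = Var nat | Ter 'a

type_synonym 'a pattern = "'a sym list"

definition is_pattern :: "'a pattern \<Rightarrow> bool" where
  "is_pattern \<pi> \<longleftrightarrow> \<pi> \<noteq> []"

definition subst :: "(nat \<Rightarrow> 'a list) \<Rightarrow> 'a pattern \<Rightarrow> 'a list" where
  "subst h \<pi> = concat (map (\<lambda>s. case s of Var x \<Rightarrow> h x | Ter a \<Rightarrow> [a]) \<pi>)"

definition lang :: "'a pattern \<Rightarrow> 'a list set" where
  "lang \<pi> = {subst h \<pi> | h. True}"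

definition var_list :: "'a pattern \<Rightarrow> nat list" where
  "var_list \<pi> = concat (map (\<lambda>s. case s of Var x \<Rightarrow> [x] | Ter _ \<Rightarrow> []) \<pi>)"

definition regular_patterns :: "'a pattern set" where
  "regular_patterns = {\<pi>. is_pattern \<pi> \<and> distinct (var_list \<pi>)}"

fun interleave :: "nat list list \<Rightarrow> 'a list \<Rightarrow> 'a pattern" where
  "interleave [] as = []"
| "interleave [X] as = map Var X"
| "interleave (X # Y # Xs) [] = []"
| "interleave (X # Y # Xs) (a # as) = map Var X @ [Ter a] @ interleave (Y # Xs) as"

definition simple_block_regular :: "'a pattern set" where
  "simple_block_regular = {\<pi>. \<exists>Xs as.
      Xs \<noteq> [] \<and> length Xs = Suc (length as) \<and>
      (\<forall>X \<in> set Xs. X \<noteq> []) \<and>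
      (\<forall>i < length Xs. \<exists>x \<in> set (Xs ! i). \<forall>j < length Xs. j \<noteq> i \<longrightarrow> x \<notin> set (Xs ! j)) \<and>
      \<pi> = interleave Xs as}"

type_synonym 'a example = "'a list \<times> bool"

definition consistent :: "'a pattern \<Rightarrow> 'a example set \<Rightarrow> bool" where
  "consistent \<tau> T \<longleftrightarrow> (\<forall>(w, b) \<in> T. (w \<in> lang \<tau> \<longleftrightarrow> b))"

definition teaching_set :: "'a example set \<Rightarrow> 'a pattern \<Rightarrow> 'a pattern set \<Rightarrow> bool" where
  "teaching_set T \<pi> C \<longleftrightarrow> consistent \<pi> T \<and>
     (\<forall>\<tau> \<in> C. consistent \<tau> T \<longrightarrow> lang \<tau> = lang \<pi>)"

definition TD :: "'a pattern \<Rightarrow> 'a pattern set \<Rightarrow> enat" where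
  "TD \<pi> C = (INF T \<in> {T. finite T \<and> teaching_set T \<pi> C}. enat (card T))"

definition TD_class :: "'a pattern set \<Rightarrow> 'a pattern set \<Rightarrow> enat" where
  "TD_class C' C = (SUP \<pi> \<in> C'. TD \<pi> C)"

end

theory Submission
  imports Defs "HOL-Library.Sublist"
begin

text \<open>
  Let \<open>w\<close> be the string of letters of a simple block-regular pattern \<open>\<pi>\<close>.

  If every gap of \<open>w\<close> holds a variable that occurs only once in \<open>\<pi>\<close>, then \<open>lang \<pi>\<close> consists of all
  words with the subsequence \<open>w\<close>. Over at least three letters one takes positive examples \<open>p\<close> and
  \<open>q\<close> which arise from \<open>w\<close> by filling its gaps in such a way that \<open>p\<close> and \<open>q\<close> have no common factor
  of length 2 and that \<open>w\<close> is a maximal common subsequence. A regular pattern matching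
  both must have variables in all gaps, so its language is given by its string \<open>u\<close> of letters. The
  words avoiding the subsequence \<open>w\<close> are directed, hence one such word \<open>v\<close> contains every
  subsequence of \<open>p\<close> that avoids \<open>w\<close>; as a negative example it forces \<open>w\<close> into \<open>u\<close>, so \<open>u = w\<close>. Over
  two letters, the factors \<open>ab\<close> and \<open>ba\<close> cannot be avoided, but they are harmless.

  The definition of simple block-regular patterns also admits gaps without such a variable, as in
  the pattern \<open>xx\<close>. If such a gap matters, then \<open>w\<close> with one letter inserted there is a negative
  example that, together with two positive ones, excludes all regular patterns.

  Conversely, the pattern \<open>xay\<close> needs a negative example to exclude the pattern \<open>x\<close>, and two positive
  ones to exclude all patterns without variables.
\<close>

section \<open>Matching with independent variables\<close>

lemma subst_simps [simp]:
  "subst h [] = []"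
  "subst h (Var x # \<pi>) = h x @ subst h \<pi>"
  "subst h (Ter a # \<pi>) = a # subst h \<pi>"
  by (simp_all add: subst_def)

lemma subst_append [simp]: "subst h (\<pi> @ \<sigma>) = subst h \<pi> @ subst h \<sigma>"
  by (simp add: subst_def)

lemma var_list_simps [simp]:
  "var_list [] = []"
  "var_list (Var x # \<pi>) = x # var_list \<pi>"
  "var_list (Ter a # \<pi>) = var_list \<pi>"
  by (simp_all add: var_list_def)

fun letters :: "'a pattern \<Rightarrow> 'a list" where
  "letters [] = []"
| "letters (Var x # \<pi>) = letters \<pi>"
| "letters (Ter a # \<pi>) = a # letters \<pi>"

lemma letters_append [simp]: "letters (\<pi> @ \<sigma>) = letters \<pi> @ letters \<sigma>"
  by (induction \<pi> rule: letters.induct) auto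

lemma letters_map_Var [simp]: "letters (map Var X) = []"
  by (induction X) auto

text \<open>Every occurrence of a variable is read as an independent wildcard.\<close>

fun matches :: "'a pattern \<Rightarrow> 'a list \<Rightarrow> bool" where
  "matches [] z \<longleftrightarrow> z = []"
| "matches (Var x # \<pi>) z \<longleftrightarrow> (\<exists>s t. z = s @ t \<and> matches \<pi> t)"
| "matches (Ter a # \<pi>) z \<longleftrightarrow> (\<exists>t. z = a # t \<and> matches \<pi> t)"

lemma letters_map_Ter [simp]: "letters (map Ter l) = l"
  by (induction l) auto

lemma matches_map_Ter [simp]: "matches (map Ter l) z \<longleftrightarrow> z = l"
  by (induction l arbitrary: z) auto

lemma matches_subst: "matches \<pi> (subst h \<pi>)"
  by (induction \<pi> rule: letters.induct) auto

lemma matches_letters: "matches \<pi> (letters \<pi>)"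
  by (induction \<pi> rule: letters.induct) auto

lemma matches_append:
  "matches (\<pi> @ \<sigma>) z \<longleftrightarrow> (\<exists>s t. z = s @ t \<and> matches \<pi> s \<and> matches \<sigma> t)"
proof (induction \<pi> arbitrary: z rule: letters.induct)
  case (2 x \<pi>)
  show ?case
    by (simp add: 2) (metis append.assoc)
next
  case (3 a \<pi>)
  show ?case
    by (simp add: 3) (metis append_Cons)
qed simp

lemma matches_imp_subseq: "matches \<pi> z \<Longrightarrow> subseq (letters \<pi>) z"
  by (induction \<pi> arbitrary: z rule: letters.induct) auto

lemma matches_length: "matches \<pi> z \<Longrightarrow> length (letters \<pi>) \<le> length z"
  using list_emb_length matches_imp_subseq by blast

lemma matches_same_length:
  "\<lbrakk>matches \<pi> z; length z \<le> length (letters \<pi>)\<rbrakk> \<Longrightarrow> z = letters \<pi>"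
  by (metis matches_imp_subseq matches_length le_antisym subseq_same_length)

lemma subst_cong:
  "(\<And>x. x \<in> set (var_list \<pi>) \<Longrightarrow> h x = g x) \<Longrightarrow> subst h \<pi> = subst g \<pi>"
  by (induction \<pi> rule: letters.induct) auto

lemma matches_imp_lang:
  assumes "distinct (var_list \<pi>)" "matches \<pi> z"
  shows "z \<in> lang \<pi>"
proof -
  have "\<exists>h. z = subst h \<pi>" using assms
  proof (induction \<pi> arbitrary: z rule: letters.induct)
    case (2 x \<pi>)
    then obtain s t where st: "z = s @ t" "matches \<pi> t" by auto
    with 2 obtain h where "t = subst h \<pi>" by force
    moreover have "subst (h(x := s)) \<pi> = subst h \<pi>"
      using 2 by (intro subst_cong) auto
    ultimately have "z = subst (h(x := s)) (Var x # \<pi>)" using st by simp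
    then show ?case by blast
  next
    case (3 a \<pi>)
    then obtain t where t: "z = a # t" "matches \<pi> t" by auto
    with 3 obtain h where "t = subst h \<pi>" by auto
    with t have "z = subst h (Ter a # \<pi>)" by simp
    then show ?case by blast
  qed simp
  then show ?thesis by (auto simp: lang_def)
qed

lemma lang_imp_matches: "z \<in> lang \<pi> \<Longrightarrow> matches \<pi> z"
  by (auto simp: lang_def matches_subst)

lemma lang_regular: "\<pi> \<in> regular_patterns \<Longrightarrow> lang \<pi> = {z. matches \<pi> z}"
  by (auto simp: regular_patterns_def intro: matches_imp_lang lang_imp_matches)

lemma letters_in_lang: "letters \<pi> \<in> lang \<pi>"
proof -
  have "letters \<pi> = subst (\<lambda>_. []) \<pi>"
    by (induction \<pi> rule: letters.induct) auto
  then show ?thesis by (auto simp: lang_def)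
qed

section \<open>Inserting words into a matched word\<close>

text \<open>A variable whose image contains or touches the cut can absorb \<open>c\<close>.
  Otherwise the cut lies between two letters of \<open>\<tau>\<close> or at an end of
  \<open>\<tau>\<close>, and \<open>\<tau>\<close> splits there.\<close>

lemma matches_cut:
  assumes "matches \<tau> (s1 @ s2)"
  shows "(\<forall>c. matches \<tau> (s1 @ c @ s2)) \<or>
    (\<exists>\<tau>1 \<tau>2. \<tau> = \<tau>1 @ \<tau>2 \<and> matches \<tau>1 s1 \<and> matches \<tau>2 s2 \<and>
      (\<tau>1 = [] \<or> (\<exists>a \<sigma>. \<tau>1 = \<sigma> @ [Ter a])) \<and> (\<tau>2 = [] \<or> (\<exists>a \<sigma>. \<tau>2 = Ter a # \<sigma>)))"
  using assms
proof (induction \<tau> arbitrary: s1 rule: letters.induct)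
  case 1
  then show ?case by auto
next
  case (2 x \<tau>)
  then obtain s t where st: "s1 @ s2 = s @ t" "matches \<tau> t" by auto
  then consider r where "s = s1 @ r" "s2 = r @ t" | r where "s1 = s @ r" "t = r @ s2"
    by (auto simp: append_eq_append_conv2)
  then show ?case
  proof cases
    case 1
    then have "s1 @ c @ s2 = (s1 @ c @ r) @ t" for c by simp
    then have "matches (Var x # \<tau>) (s1 @ c @ s2)" for c
      using st(2) matches.simps(2) by blast
    then show ?thesis by blast
  next
    case r: 2
    consider "\<forall>c. matches \<tau> (r @ c @ s2)"
      | \<tau>1 \<tau>2 where "\<tau> = \<tau>1 @ \<tau>2" "matches \<tau>1 r" "matches \<tau>2 s2"
        "\<tau>1 = [] \<or> (\<exists>a \<sigma>. \<tau>1 = \<sigma> @ [Ter a])" "\<tau>2 = [] \<or> (\<exists>a \<sigma>. \<tau>2 = Ter a # \<sigma>)"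
      using 2(1)[of r] st(2) r by blast
    then show ?thesis
    proof cases
      case 1
      then show ?thesis using r by auto
    next
      case (2 \<tau>1 \<tau>2)
      show ?thesis
      proof (cases "\<tau>1 = []")
        case True
        then have "s1 @ c @ s2 = (s1 @ c) @ s2" "matches \<tau> s2" for c
          using 2 by simp_all
        then have "matches (Var x # \<tau>) (s1 @ c @ s2)" for c
          using matches.simps(2) by blast
        then show ?thesis by blast
      next
        case False
        with 2 obtain a \<sigma> where "\<tau>1 = \<sigma> @ [Ter a]" by blast
        moreover have "matches (Var x # \<tau>1) s1" using 2 r by auto
        ultimately have "Var x # \<tau> = (Var x # \<tau>1) @ \<tau>2 \<and> matches (Var x # \<tau>1) s1 \<and>
          matches \<tau>2 s2 \<and> Var x # \<tau>1 = (Var x # \<sigma>) @ [Ter a]"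
          using 2 by simp
        then show ?thesis using 2(5) by blast
      qed
    qed
  qed
next
  case (3 a \<tau>)
  show ?case
  proof (cases s1)
    case Nil
    then show ?thesis using 3(2) by fastforce
  next
    case (Cons b r)
    then have b: "b = a" and m: "matches \<tau> (r @ s2)" using 3(2) by auto
    consider "\<forall>c. matches \<tau> (r @ c @ s2)"
      | \<tau>1 \<tau>2 where "\<tau> = \<tau>1 @ \<tau>2" "matches \<tau>1 r" "matches \<tau>2 s2"
        "\<tau>1 = [] \<or> (\<exists>a \<sigma>. \<tau>1 = \<sigma> @ [Ter a])" "\<tau>2 = [] \<or> (\<exists>a \<sigma>. \<tau>2 = Ter a # \<sigma>)"
      using 3(1)[OF m] by blast
    then show ?thesis
    proof cases
      case 1
      then show ?thesis using Cons b by auto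
    next
      case (2 \<tau>1 \<tau>2)
      have "\<exists>a' \<sigma>. Ter a # \<tau>1 = \<sigma> @ [Ter a']"
        using 2(4) by (metis append_Cons append_Nil)
      moreover have "Ter a # \<tau> = (Ter a # \<tau>1) @ \<tau>2" "matches (Ter a # \<tau>1) s1"
        using 2 Cons b by auto
      ultimately show ?thesis using 2(3,5) by blast
    qed
  qed
qed

text \<open>Both halves at the cut match nonempty words, so neither is empty, and the letters of
  \<open>\<tau>\<close> next to the cut must be \<open>x\<close> and \<open>y\<close>. Only a factor
  \<open>x y\<close> of \<open>\<tau>\<close> can block an insertion.\<close>

lemma matches_insert:
  assumes "matches \<tau> (s1 @ [x] @ [y] @ s2)"
  obtains "\<And>c. matches \<tau> (s1 @ [x] @ c @ [y] @ s2)"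
  | \<tau>1 \<tau>2 where "\<tau> = \<tau>1 @ [Ter x, Ter y] @ \<tau>2" "matches \<tau>1 s1" "matches \<tau>2 s2"
proof -
  have "matches \<tau> ((s1 @ [x]) @ ([y] @ s2))" using assms by simp
  from matches_cut[OF this] consider "\<And>c. matches \<tau> (s1 @ [x] @ c @ [y] @ s2)"
    | \<tau>1 \<tau>2 where "\<tau> = \<tau>1 @ \<tau>2" "matches \<tau>1 (s1 @ [x])" "matches \<tau>2 ([y] @ s2)"
      "\<tau>1 = [] \<or> (\<exists>a \<sigma>. \<tau>1 = \<sigma> @ [Ter a])" "\<tau>2 = [] \<or> (\<exists>a \<sigma>. \<tau>2 = Ter a # \<sigma>)"
    by (simp only: append.assoc append_Nil append_Nil2) blast
  then show thesis
  proof cases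
    case 1
    then show ?thesis using that(1) by blast
  next
    case (2 \<tau>1 \<tau>2)
    then obtain a \<sigma> b \<rho> where "\<tau>1 = \<sigma> @ [Ter a]" "\<tau>2 = Ter b # \<rho>" by fastforce
    with 2 show ?thesis by (intro that(2)[of \<sigma> \<rho>]) (auto simp: matches_append)
  qed
qed

lemma matches_insert_front:
  assumes "matches \<tau> (y # s)"
  obtains "\<And>c. matches \<tau> (c @ y # s)" | \<sigma> where "\<tau> = Ter y # \<sigma>" "matches \<sigma> s"
proof -
  have "matches \<tau> ([] @ (y # s))" using assms by simp
  from matches_cut[OF this] consider "\<And>c. matches \<tau> (c @ y # s)"
    | \<tau>1 \<tau>2 where "\<tau> = \<tau>1 @ \<tau>2" "matches \<tau>1 []" "matches \<tau>2 (y # s)"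
      "\<tau>1 = [] \<or> (\<exists>a \<sigma>. \<tau>1 = \<sigma> @ [Ter a])" "\<tau>2 = [] \<or> (\<exists>a \<sigma>. \<tau>2 = Ter a # \<sigma>)"
    by (simp only: append.assoc append_Nil append_Nil2) blast
  then show thesis
    by cases (use that in \<open>auto simp: matches_append\<close>)
qed

lemma matches_insert_back:
  assumes "matches \<tau> (s @ [y])"
  obtains "\<And>c. matches \<tau> (s @ [y] @ c)" | \<sigma> where "\<tau> = \<sigma> @ [Ter y]" "matches \<sigma> s"
proof -
  have "matches \<tau> ((s @ [y]) @ [])" using assms by simp
  from matches_cut[OF this] consider "\<And>c. matches \<tau> (s @ [y] @ c)"
    | \<tau>1 \<tau>2 where "\<tau> = \<tau>1 @ \<tau>2" "matches \<tau>1 (s @ [y])" "matches \<tau>2 []"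
      "\<tau>1 = [] \<or> (\<exists>a \<sigma>. \<tau>1 = \<sigma> @ [Ter a])" "\<tau>2 = [] \<or> (\<exists>a \<sigma>. \<tau>2 = Ter a # \<sigma>)"
    by (simp only: append.assoc append_Nil append_Nil2) blast
  then show thesis
    by cases (use that in \<open>auto simp: matches_append\<close>)
qed

section \<open>Variables with a single occurrence\<close>

definition restrict_vars :: "nat set \<Rightarrow> 'a pattern \<Rightarrow> 'a pattern" where
  "restrict_vars A \<pi> = filter (\<lambda>s. case s of Var x \<Rightarrow> x \<in> A | Ter a \<Rightarrow> True) \<pi>"

lemma restrict_vars_simps [simp]:
  "restrict_vars A [] = []"
  "restrict_vars A (Var x # \<pi>) = (if x \<in> A then Var x # restrict_vars A \<pi> else restrict_vars A \<pi>)"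
  "restrict_vars A (Ter a # \<pi>) = Ter a # restrict_vars A \<pi>"
  by (simp_all add: restrict_vars_def)

lemma letters_restrict_vars [simp]: "letters (restrict_vars A \<pi>) = letters \<pi>"
  by (induction \<pi> rule: letters.induct) auto

lemma var_list_restrict_vars: "var_list (restrict_vars A \<pi>) = filter (\<lambda>x. x \<in> A) (var_list \<pi>)"
  by (induction \<pi> rule: letters.induct) auto

lemma subst_restrict_vars:
  "subst h (restrict_vars A \<pi>) = subst (\<lambda>x. if x \<in> A then h x else []) \<pi>"
  by (induction \<pi> rule: letters.induct) auto

lemma distinct_filter_count_list:
  "(\<And>x. x \<in> A \<Longrightarrow> count_list xs x \<le> 1) \<Longrightarrow> distinct (filter (\<lambda>x. x \<in> A) xs)"
proof (induction xs)
  case (Cons y ys)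
  have "count_list ys x \<le> 1" if "x \<in> A" for x
    using Cons.prems[OF that] by (simp split: if_splits)
  moreover have "y \<notin> set ys" if "y \<in> A"
    using Cons.prems[OF that] by (simp add: count_list_0_iff)
  ultimately show ?case using Cons.IH by auto
qed simp

text \<open>Without its repeated variables the pattern has distinct variables, so
  \<open>matches\<close> describes its language exactly. This language lies inside
  \<open>lang \<pi>\<close>, since repeated variables may be sent to the empty word.\<close>

definition once :: "'a pattern \<Rightarrow> 'a pattern" where
  "once \<pi> = restrict_vars {x. count_list (var_list \<pi>) x = 1} \<pi>"

lemma letters_once [simp]: "letters (once \<pi>) = letters \<pi>"
  by (simp add: once_def)

lemma matches_once_imp_lang:
  assumes "matches (once \<pi>) z"
  shows "z \<in> lang \<pi>"
proof -
  have "distinct (var_list (once \<pi>))"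
    unfolding once_def var_list_restrict_vars by (rule distinct_filter_count_list) simp
  with assms have "z \<in> lang (once \<pi>)" by (rule matches_imp_lang[rotated])
  then show ?thesis by (auto simp: lang_def once_def subst_restrict_vars)
qed

lemma length_subst:
  "length (subst h \<pi>) = length (letters \<pi>) + sum_list (map (\<lambda>x. length (h x)) (var_list \<pi>))"
  by (induction \<pi> rule: letters.induct) auto

lemma count_list_times_le_sum_list:
  fixes f :: "'a \<Rightarrow> nat"
  shows "count_list xs x * f x \<le> sum_list (map f xs)"
  by (induction xs) auto

text \<open>The extra letter can only come from a variable with a single occurrence.\<close>

lemma lang_imp_matches_once:
  assumes "z \<in> lang \<pi>" "length z = Suc (length (letters \<pi>))"
  shows "matches (once \<pi>) z"
proof -
  obtain h where h: "z = subst h \<pi>" using assms by (auto simp: lang_def)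
  with assms(2) have one: "sum_list (map (\<lambda>x. length (h x)) (var_list \<pi>)) = 1"
    by (simp add: length_subst)
  have "h x = []" if "x \<in> set (var_list \<pi>)" "count_list (var_list \<pi>) x \<noteq> 1" for x
  proof (rule ccontr)
    assume "h x \<noteq> []"
    moreover have "count_list (var_list \<pi>) x \<noteq> 0" using that by (simp add: count_list_0_iff)
    \<comment> \<open>A repeated variable with a nonempty image would contribute at least two
      letters, but only one is available.\<close>
    ultimately have "2 * 1 \<le> count_list (var_list \<pi>) x * length (h x)"
      using that(2) by (intro mult_le_mono) (auto simp: Suc_le_eq)
    with one count_list_times_le_sum_list[of "var_list \<pi>" x "\<lambda>x. length (h x)"]
    show False by simp
  qed
  then have "z = subst h (once \<pi>)"
    unfolding h once_def subst_restrict_vars by (intro subst_cong) auto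
  then show ?thesis using matches_subst by metis
qed

section \<open>Filling the gaps with powers\<close>

definition pw :: "nat \<Rightarrow> 'a list \<Rightarrow> 'a list" where
  "pw n s = concat (replicate n s)"

lemma pw_simps [simp]: "pw 0 s = []" "pw (Suc n) s = s @ pw n s" "pw n [] = []"
  by (simp_all add: pw_def)

lemma pw_add: "pw (m + n) s = pw m s @ pw n s"
  by (simp add: pw_def replicate_add)

lemma pw_mult: "pw m (pw n s) = pw (m * n) s"
  by (induction m) (simp_all add: pw_add)

lemma pw_single [simp]: "pw n [c] = replicate n c"
  by (induction n) auto

lemma concat_map_single_support:
  assumes "\<And>x. x \<in> set X \<Longrightarrow> x \<noteq> y \<Longrightarrow> h x = []"
  shows "concat (map h X) = pw (count_list X y) (h y)"
  using assms by (induction X) auto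

text \<open>The result starts after the letter \<open>a\<close>, which only determines the first gap.\<close>

fun fill :: "('a \<Rightarrow> 'a \<Rightarrow> 'a list) \<Rightarrow> 'a list \<Rightarrow> 'a \<Rightarrow> 'a list \<Rightarrow> 'a list" where
  "fill C t a [] = t"
| "fill C t a (b # w) = C a b @ b # fill C t b w"

lemma subst_map_Var: "subst h (map Var X) = concat (map h X)"
  by (induction X) auto

lemma subst_interleave:
  assumes "length Xs = Suc (length w)"
    and "\<And>i. i < length w \<Longrightarrow> concat (map h (Xs ! i)) = C ((a # w) ! i) (w ! i)"
    and "concat (map h (Xs ! length w)) = t"
  shows "subst h (interleave Xs w) = fill C t a w"
  using assms
proof (induction w arbitrary: Xs a)
  case Nil
  then obtain X where "Xs = [X]" by (metis length_0_conv length_Suc_conv list.size(3))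
  then show ?case using Nil by (simp add: subst_map_Var)
next
  case (Cons b w)
  then obtain X Y Xs' where Xs: "Xs = X # Y # Xs'"
    by (metis length_Suc_conv)
  have "subst h (interleave (Y # Xs') w) = fill C t b w"
  proof (rule Cons.IH)
    show "length (Y # Xs') = Suc (length w)" using Cons.prems(1) Xs by simp
    show "concat (map h ((Y # Xs') ! i)) = C ((b # w) ! i) (w ! i)" if "i < length w" for i
      using Cons.prems(2)[of "Suc i"] that Xs by simp
    show "concat (map h ((Y # Xs') ! length w)) = t" using Cons.prems(3) Xs by simp
  qed
  moreover have "concat (map h X) = C a b" using Cons.prems(2)[of 0] Xs by simp
  ultimately show ?case using Xs by (simp add: subst_map_Var)
qed

lemma letters_interleave: "length Xs = Suc (length w) \<Longrightarrow> letters (interleave Xs w) = w"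
  by (induction Xs w rule: interleave.induct) auto

text \<open>Each block has a private variable; taking \<open>M\<close> to be the product of their multiplicities,
  \<open>M\<close>-th powers can be placed in all gaps independently.\<close>

lemma simple_block_regular_fill:
  assumes "\<pi> \<in> simple_block_regular" "letters \<pi> = a # w"
  shows "\<exists>M\<ge>1. \<forall>s C t. pw M s @ a # fill (\<lambda>x y. pw M (C x y)) (pw M t) a w \<in> lang \<pi>"
proof -
  obtain Xs as where len: "length Xs = Suc (length as)" and
    priv: "\<forall>i < length Xs. \<exists>x \<in> set (Xs ! i). \<forall>j < length Xs. j \<noteq> i \<longrightarrow> x \<notin> set (Xs ! j)" and
    \<pi>: "\<pi> = interleave Xs as"
    using assms(1) by (auto simp: simple_block_regular_def)
  have as: "as = a # w" using assms(2) letters_interleave[OF len] \<pi> by simp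
  define n where "n = length Xs"
  from priv obtain y where y: "\<And>i. i < n \<Longrightarrow> y i \<in> set (Xs ! i)"
    "\<And>i j. i < n \<Longrightarrow> j < n \<Longrightarrow> j \<noteq> i \<Longrightarrow> y i \<notin> set (Xs ! j)"
    unfolding n_def by metis
  have inj: "inj_on y {..<n}" using y by (metis inj_onI lessThan_iff)
  define k where "k i = count_list (Xs ! i) (y i)" for i
  define M where "M = prod k {..<n}"
  have k1: "k i \<noteq> 0" if "i < n" for i using y(1)[OF that] by (simp add: k_def count_list_0_iff)
  then have M1: "M \<ge> 1" by (simp add: M_def Suc_le_eq prod_pos)
  have kM: "k i * (M div k i) = M" if "i < n" for i
    using that by (simp add: M_def dvd_prodI)
  have "pw M s @ a # fill (\<lambda>x y. pw M (C x y)) (pw M t) a w \<in> lang \<pi>" for s C t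
  proof -
    define G where "G i = (if i = 0 then s else if i = length as then t else C (as ! (i - 1)) (as ! i))" for i
    \<comment> \<open>The private variable of block \<open>i\<close> occurs \<open>k i\<close> times
      there, so the exponent \<open>M div k i\<close> yields an \<open>M\<close>-th power in total.
      All other variables are erased; injectivity of \<open>y\<close> lets \<open>inv_into\<close>
      recover the block.\<close>
    define h where "h x = (if x \<in> y ` {..<n} then
      (let i = inv_into {..<n} y x in pw (M div k i) (G i)) else [])" for x
    have block: "concat (map h (Xs ! i)) = pw M (G i)" if "i < n" for i
    proof -
      have "concat (map h (Xs ! i)) = pw (count_list (Xs ! i) (y i)) (h (y i))"
      proof (rule concat_map_single_support)
        fix x assume "x \<in> set (Xs ! i)" "x \<noteq> y i"
        then have "x \<notin> y ` {..<n}" using y(2) that by auto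
        then show "h x = []" by (simp add: h_def)
      qed
      moreover have "h (y i) = pw (M div k i) (G i)"
        using that inj by (simp add: h_def)
      ultimately show ?thesis using kM[OF that] by (simp add: pw_mult flip: k_def)
    qed
    obtain X Y Xs' where Xs: "Xs = X # Y # Xs'"
      using len as by (metis length_Cons length_Suc_conv)
    have "subst h (interleave (Y # Xs') w) = fill (\<lambda>x y. pw M (C x y)) (pw M t) a w"
    proof (rule subst_interleave)
      show "length (Y # Xs') = Suc (length w)" using len as Xs by simp
      show "concat (map h ((Y # Xs') ! i)) = pw M (C ((a # w) ! i) (w ! i))"
        if "i < length w" for i
        using block[of "Suc i"] that len as by (simp add: n_def Xs G_def)
      show "concat (map h ((Y # Xs') ! length w)) = pw M t"
        using block[of "Suc (length w)"] len as by (simp add: n_def Xs G_def)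
    qed
    moreover have "concat (map h X) = pw M s"
      using block[of 0] by (simp add: n_def Xs G_def)
    ultimately have "subst h \<pi> = pw M s @ a # fill (\<lambda>x y. pw M (C x y)) (pw M t) a w"
      by (simp add: \<pi> Xs as subst_map_Var)
    then show ?thesis by (auto simp: lang_def intro: exI[of _ h])
  qed
  with M1 show ?thesis by blast
qed

section \<open>Gapped patterns and shuffle ideals\<close>

lemma subseq_imp_subset: "subseq u z \<Longrightarrow> set u \<subseteq> set z"
  by (auto simp: subseq_conv_nths dest: in_set_nthsD)

lemma subseq_Cons_append_skip:
  "a \<notin> set b \<Longrightarrow> subseq (a # w) (b @ z) \<longleftrightarrow> subseq (a # w) z"
  by (induction b) auto

text \<open>Over a binary alphabet, the first \<open>b\<close> after an \<open>a\<close> is preceded by \<open>a\<close>; so a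
  missing gap between different letters does not restrict the language, provided that the
  neighbouring gaps are present.\<close>

inductive gapped :: "'a pattern \<Rightarrow> bool" where
  "gapped [Var x]"
| "gapped \<tau> \<Longrightarrow> gapped (Var x # \<tau>)"
| "gapped \<tau> \<Longrightarrow> gapped (Var x # Ter a # \<tau>)"
| "\<lbrakk>gapped \<tau>; a \<noteq> b; UNIV = {a, b}\<rbrakk> \<Longrightarrow> gapped (Var x # Ter a # Ter b # \<tau>)"

lemma gapped_matches: "\<lbrakk>gapped \<tau>; subseq (letters \<tau>) z\<rbrakk> \<Longrightarrow> matches \<tau> z"
proof (induction arbitrary: z rule: gapped.induct)
  case (1 x)
  then show ?case by simp
next
  case (2 \<tau> x)
  then show ?case by auto
next
  case (3 \<tau> x a)
  then obtain z1 z2 where z: "z = z1 @ a # z2" "subseq (letters \<tau>) z2"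
    by (auto dest: list_emb_ConsD)
  with 3 have "matches (Ter a # \<tau>) (a # z2)" by simp
  then show ?case using z matches.simps(2) by blast
next
  case (4 \<tau> a b x)
  have two: "y = a \<or> y = b" for y using "4.hyps"(3) by blast
  have "subseq (a # b # letters \<tau>) z" using "4.prems" by (simp only: letters.simps)
  from list_emb_ConsD[OF this] obtain z1 z2 where z: "z = z1 @ a # z2" "subseq (b # letters \<tau>) z2"
    by blast
  have "b \<in> set z2" using subseq_imp_subset[OF z(2)] by simp
  then obtain z3 z4 where z34: "z2 = z3 @ b # z4" "b \<notin> set z3" by (meson split_list_first)
  then have z4: "subseq (letters \<tau>) z4" using z by (simp add: subseq_Cons_append_skip)
  have "set z3 \<subseteq> {a}" using z34(2) two by auto
  \<comment> \<open>A power of \<open>a\<close> commutes with \<open>a\<close>: the \<open>a\<close>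
    directly before the first \<open>b\<close> can serve as \<open>Ter a\<close>, and the leading
    variable absorbs the others.\<close>
  then have "a # z3 = z3 @ [a]" by (metis replicate_append_same replicate_eqI singletonD subsetD)
  then have "z = (z1 @ z3) @ a # b # z4" using z z34 by simp
  moreover have "matches (Ter a # Ter b # \<tau>) (a # b # z4)" using "4.IH" z4 by simp
  ultimately show ?case using matches.simps(2) by blast
qed

lemma gapped_matches_iff: "gapped \<tau> \<Longrightarrow> matches \<tau> z \<longleftrightarrow> subseq (letters \<tau>) z"
  using gapped_matches matches_imp_subseq by blast

text \<open>Adjacent letters are tolerated only if they are different and make up the alphabet, so
  three letters in a row would form an excluded factor \<open>a b a\<close>. Hence at most two
  letters stand between consecutive variables.\<close>

lemma gappedI:
  fixes \<tau> :: "'a pattern"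
  assumes "\<tau> \<noteq> []" "\<And>a \<sigma>. \<tau> \<noteq> Ter a # \<sigma>" "\<And>a \<sigma>. \<tau> \<noteq> \<sigma> @ [Ter a]"
    and "\<And>\<sigma>1 \<sigma>2 a b. \<tau> = \<sigma>1 @ [Ter a, Ter b] @ \<sigma>2 \<Longrightarrow> a \<noteq> b \<and> UNIV = {a, b}"
    and "\<And>\<sigma>1 \<sigma>2 a b. a \<noteq> b \<Longrightarrow> \<tau> \<noteq> \<sigma>1 @ [Ter a, Ter b, Ter a] @ \<sigma>2"
  shows "gapped \<tau>"
  using assms
proof (induction "length \<tau>" arbitrary: \<tau> rule: less_induct)
  case less
  have suffix: "gapped (Var y # \<sigma>)" if "\<tau> = pre @ Var y # \<sigma>" "pre \<noteq> []" for pre y \<sigma>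
  proof (rule less.hyps)
    show "length (Var y # \<sigma>) < length \<tau>" using that by simp
    show "a \<noteq> b \<and> UNIV = {a, b}" if "Var y # \<sigma> = \<sigma>1 @ [Ter a, Ter b] @ \<sigma>2" for \<sigma>1 \<sigma>2 a b
      using less.prems(4)[of "pre @ \<sigma>1" a b \<sigma>2] that \<open>\<tau> = pre @ Var y # \<sigma>\<close> by simp
    show "Var y # \<sigma> \<noteq> \<sigma>1 @ [Ter a, Ter b, Ter a] @ \<sigma>2" if "a \<noteq> b" for \<sigma>1 \<sigma>2 a b
      using less.prems(5)[OF that, of "pre @ \<sigma>1" \<sigma>2] \<open>\<tau> = pre @ Var y # \<sigma>\<close> by auto
    show "Var y # \<sigma> \<noteq> \<sigma>1 @ [Ter a]" for \<sigma>1 a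
      using less.prems(3)[of "pre @ \<sigma>1" a] \<open>\<tau> = pre @ Var y # \<sigma>\<close> by auto
  qed auto
  obtain x \<tau>1 where \<tau>: "\<tau> = Var x # \<tau>1"
    using less.prems(1,2) by (metis list.exhaust sym.exhaust)
  show ?case
  proof (cases \<tau>1)
    case Nil
    then show ?thesis using \<tau> by (simp add: gapped.intros)
  next
    case (Cons s \<tau>2)
    show ?thesis
    proof (cases s)
      case (Var y)
      then show ?thesis using suffix[of "[Var x]"] \<tau> Cons by (auto intro: gapped.intros)
    next
      case s: (Ter a)
      then have "\<tau>2 \<noteq> []" using less.prems(3)[of "[Var x]" a] \<tau> Cons by auto
      then obtain r \<tau>3 where \<tau>2: "\<tau>2 = r # \<tau>3" by (meson list.exhaust)
      show ?thesis
      proof (cases r)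
        case (Var y)
        then show ?thesis
          using suffix[of "[Var x, Ter a]"] \<tau> Cons s \<tau>2 by (auto intro: gapped.intros)
      next
        case r: (Ter b)
        then have "a \<noteq> b \<and> UNIV = {a, b}"
          using \<tau> Cons s \<tau>2 by (intro less.prems(4)[of "[Var x]" a b \<tau>3]) simp
        then have ab: "a \<noteq> b" "UNIV = {a, b}" by blast+
        have two: "y = a \<or> y = b" for y using ab(2) by blast
        have "\<tau>3 \<noteq> []" using less.prems(3)[of "[Var x, Ter a]" b] \<tau> Cons s \<tau>2 r by auto
        then obtain q \<tau>4 where \<tau>3: "\<tau>3 = q # \<tau>4" by (meson list.exhaust)
        show ?thesis
        proof (cases q)
          case (Var y)
          then show ?thesis
            using suffix[of "[Var x, Ter a, Ter b]" y \<tau>4] \<tau> Cons s \<tau>2 r \<tau>3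
            by (simp add: gapped.intros(4)[OF _ ab])
        next
          case q: (Ter c)
          have "b \<noteq> c \<and> UNIV = {b, c}"
            using \<tau> Cons s \<tau>2 r \<tau>3 q by (intro less.prems(4)[of "[Var x, Ter a]" b c \<tau>4]) simp
          then have "c = a" using two by metis
          then show ?thesis
            using less.prems(5)[OF ab(1), of "[Var x]" \<tau>4] \<tau> Cons s \<tau>2 r \<tau>3 q by simp
        qed
      qed
    qed
  qed
qed

section \<open>Words avoiding a subsequence\<close>

text \<open>Both words are cut at the first occurrence of the first letter of \<open>w\<close>. The
  parts before it lack this letter and can be concatenated; the parts after it avoid the rest of
  \<open>w\<close> and are joined by induction.\<close>

lemma avoiding_directed2:
  "\<lbrakk>\<not> subseq w u1; \<not> subseq w u2\<rbrakk> \<Longrightarrow> \<exists>v. subseq u1 v \<and> subseq u2 v \<and> \<not> subseq w v"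
proof (induction w arbitrary: u1 u2)
  case Nil
  then show ?case by simp
next
  case (Cons a w)
  show ?case
  \<comment> \<open>A single letter needs its own case, because no tail avoids the empty
    word.\<close>
  proof (cases "w = []")
    case True
    then have "a \<notin> set (u1 @ u2)" using Cons.prems by (simp add: subseq_singleton_left)
    then show ?thesis using True
      by (intro exI[of _ "u1 @ u2"])
        (auto simp: subseq_singleton_left intro: list_emb_append2)
  next
    case False
    have split: "\<exists>b r. a \<notin> set b \<and> subseq u (b @ a # r) \<and> \<not> subseq w r" if "\<not> subseq (a # w) u" for u
    proof (cases "a \<in> set u")
      case True
      then obtain b r where "u = b @ a # r" "a \<notin> set b" by (meson split_list_first)
      with that show ?thesis by (auto simp: subseq_Cons_append_skip)
    next
      case no: False
      \<comment> \<open>If \<open>u\<close> lacks \<open>a\<close>, an \<open>a\<close> is appended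
        to it; the tail \<open>[]\<close> avoids the nonempty \<open>w\<close>.\<close>
      then show ?thesis using False
        by (intro exI[of _ u] exI[of _ "[]"]) (auto intro: subseq_rev_drop_many)
    qed
    obtain b1 r1 where 1: "a \<notin> set b1" "subseq u1 (b1 @ a # r1)" "\<not> subseq w r1"
      using split Cons.prems by blast
    obtain b2 r2 where 2: "a \<notin> set b2" "subseq u2 (b2 @ a # r2)" "\<not> subseq w r2"
      using split Cons.prems by blast
    obtain r where r: "subseq r1 r" "subseq r2 r" "\<not> subseq w r"
      using Cons.IH 1 2 by blast
    let ?v = "(b1 @ b2) @ a # r"
    have "subseq (b1 @ a # r1) ?v" "subseq (b2 @ a # r2) ?v"
      using r by (simp_all add: subseq_append' subseq_drop_many)
    then have "subseq u1 ?v" "subseq u2 ?v"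
      using 1 2 subseq_order.order_trans by blast+
    moreover have "\<not> subseq (a # w) ?v"
      using 1 2 r by (subst subseq_Cons_append_skip) auto
    ultimately show ?thesis by blast
  qed
qed

lemma avoiding_directed:
  assumes "w \<noteq> []" "finite F" "\<And>u. u \<in> F \<Longrightarrow> \<not> subseq w u"
  shows "\<exists>v. (\<forall>u \<in> F. subseq u v) \<and> \<not> subseq w v"
  using assms(2,3)
proof (induction F rule: finite_induct)
  case empty
  then show ?case using assms(1) by (intro exI[of _ "[]"]) auto
next
  case (insert x F)
  then obtain v where v: "\<forall>u \<in> F. subseq u v" "\<not> subseq w v" by auto
  then obtain v' where "subseq v v'" "subseq x v'" "\<not> subseq w v'"
    using avoiding_directed2[of w v x] insert.prems by auto
  then show ?case using v subseq_order.order_trans by (intro exI[of _ v']) blast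
qed

section \<open>Words that arise by filling gaps\<close>

lemma subseq_fill: "subseq w (fill C t a w)"
  by (induction w arbitrary: a) (auto simp: subseq_drop_many)

lemma fill_no_gaps [simp]: "fill (\<lambda>x y. []) t a w = w @ t"
  by (induction w arbitrary: a) auto

lemma successively_fill:
  assumes "\<And>x y. successively P (x # C x y @ [y])" "successively P (last (a # w) # t)"
  shows "successively P (a # fill C t a w)"
  using assms(2)
proof (induction w arbitrary: a)
  case (Cons b w)
  have "successively P (b # fill C t b w)" using Cons by simp
  moreover have "successively P ((a # C a b) @ [b])" using assms(1) by simp
  ultimately have "successively P ((a # C a b) @ b # fill C t b w)"
    by (simp only: successively_append_iff) auto
  then show ?case by simp
qed simp

lemma successively_factor: "successively P (z1 @ [x, y] @ z2) \<Longrightarrow> P x y"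
  by (simp add: successively_append_iff)

text \<open>The leading \<open>b\<close> could at best be spent on \<open>x\<close>. The gap after
  it contains no \<open>b\<close>, so \<open>b\<close> must be found from the next letter of
  \<open>w\<close> on, which is the same situation one letter later with \<open>b\<close> in the
  role of \<open>x\<close>.\<close>

lemma fill_tight:
  assumes "\<And>x y. x \<notin> set (C x y)" "last (b # w) \<notin> set t"
  shows "\<not> subseq (x # b # w) (b # fill C t b w)"
  using assms(2)
proof (induction w arbitrary: b x)
  case Nil
  then show ?case by (cases "x = b") (auto simp: subseq_singleton_left dest: subseq_Cons')
next
  case (Cons c w)
  show ?case
  proof
    assume "subseq (x # b # c # w) (b # fill C t b (c # w))"
    then have "subseq (b # c # w) (C b c @ c # fill C t c w)"
      by (cases "x = b") (auto dest: subseq_Cons')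
    then have "subseq (b # c # w) (c # fill C t c w)"
      using assms(1) subseq_Cons_append_skip by metis
    then show False using Cons by simp
  qed
qed

text \<open>The gap contains no \<open>b\<close>, so it receives a prefix of \<open>E\<close>. If a
  letter of \<open>E\<close> were left over, it would embed together with \<open>b # w\<close>
  behind the gap, against \<open>fill_tight\<close>.\<close>

lemma fill_peel:
  assumes "\<And>x y. x \<notin> set (C x y)" "\<And>x y. y \<notin> set (C x y)" "last (b # w) \<notin> set t"
    and "subseq (E @ b # u) (C a b @ b # fill C t b w)" "subseq w u"
  shows "subseq E (C a b)" "subseq u (fill C t b w)"
proof -
  obtain r1 r2 where r: "E @ b # u = r1 @ r2" "subseq r1 (C a b)" "subseq r2 (b # fill C t b w)"
    using assms(4) by (auto simp: subseq_append_iff)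
  have "b \<notin> set r1" using subseq_imp_subset[OF r(2)] assms(2) by blast
  then obtain e where e: "E = r1 @ e" "r2 = e @ b # u"
    using r(1) by (auto simp: append_eq_append_conv2 Cons_eq_append_conv)
  have "e = []"
  proof (rule ccontr)
    assume "e \<noteq> []"
    then have "subseq (last e # b # u) r2"
      using e by (metis append_Cons append_Nil append_butlast_last_id append_assoc list_emb_append2 subseq_order.refl)
    moreover have "subseq (last e # b # w) (last e # b # u)" using assms(5) by simp
    ultimately have "subseq (last e # b # w) (b # fill C t b w)"
      using r(3) subseq_order.order_trans by blast
    then show False using fill_tight assms(1,3) by metis
  qed
  then show "subseq E (C a b)" "subseq u (fill C t b w)" using e r by auto
qed

text \<open>The letters that \<open>u\<close> has in excess before the next letter of
  \<open>w\<close> must lie in the gap filled by \<open>C\<close>, and \<open>CD\<close> forbids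
  them in the other word. \<open>CD\<close> speaks of the whole remaining word, because
  \<open>D x y\<close> may contain \<open>x\<close> and then \<open>fill_peel\<close> does not apply
  to \<open>D\<close>.\<close>

lemma fill_common_subseq:
  assumes C: "\<And>x y. x \<notin> set (C x y)" "\<And>x y. y \<notin> set (C x y)" and D: "\<And>x y. y \<notin> set (D x y)"
    and CD: "\<And>x y E w. \<lbrakk>E \<noteq> []; subseq E (C x y); subseq (E @ y # w) (D x y @ y # fill D [] y w)\<rbrakk> \<Longrightarrow> False"
    and "last (a # w) \<notin> set t" "subseq w u" "subseq u (fill C t a w)" "subseq u (fill D [] a w)"
  shows "u = w"
  using assms(5-)
proof (induction w arbitrary: a u)
  case Nil
  then show ?case by simp
next
  case (Cons b w)
  then have "b \<in> set u" using subseq_imp_subset by fastforce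
  then obtain E u2 where u: "u = E @ b # u2" "b \<notin> set E" by (meson split_list_first)
  then have w: "subseq w u2" using Cons.prems(2) by (simp add: subseq_Cons_append_skip)
  have peel: "subseq E (C a b)" "subseq u2 (fill C t b w)"
    using fill_peel[OF C, of b w t E u2 a] Cons.prems u w by auto
  have "subseq (E @ b # w) (E @ b # u2)" using w by (simp add: subseq_append')
  then have "subseq (E @ b # w) (D a b @ b # fill D [] b w)"
    using Cons.prems(4) u subseq_order.order_trans by fastforce
  then have "E = []" using CD peel(1) by blast
  then have "subseq (b # u2) (b # fill D [] b w)"
    using Cons.prems(4) u D subseq_Cons_append_skip by (metis append_Nil fill.simps(2))
  then have "subseq u2 (fill D [] b w)" by simp
  then have "u2 = w" using Cons.IH[of b u2] Cons.prems(1) w peel by auto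
  then show ?case using u \<open>E = []\<close> by simp
qed

text \<open>This excludes factors \<open>x y x\<close> with \<open>x \<noteq> y\<close>; the first
  and the last letter are unconstrained.\<close>

fun no_isolated :: "'a list \<Rightarrow> bool" where
  "no_isolated (x # y # z # l) \<longleftrightarrow> (x = y \<or> y = z) \<and> no_isolated (y # z # l)"
| "no_isolated _ \<longleftrightarrow> True"

lemma no_isolated_factor: "no_isolated (z1 @ [x, y, z] @ z2) \<Longrightarrow> x = y \<or> y = z"
proof (induction z1)
  case (Cons a z1)
  then show ?case by (cases z1; cases "tl z1") auto
qed simp

lemma no_isolated_replicate:
  assumes "no_isolated (a # l)"
  shows "no_isolated (a # replicate n a @ l)"
proof (induction n)
  case (Suc n)
  then show ?case by (cases "replicate n a @ l") auto
qed (use assms in simp)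

text \<open>A letter followed by a different letter of the word is repeated in the gap between them,
  so it has an equal neighbour. The letter \<open>d\<close> is arbitrary, being at the end.\<close>

lemma no_isolated_fill:
  assumes "M \<ge> 1"
  shows "no_isolated (d # a # fill (\<lambda>x y. pw M (if x = y then [] else [x])) [] a w)"
proof (induction w arbitrary: d a)
  case (Cons b w)
  let ?D = "\<lambda>x y. pw M (if x = y then [] else [x])"
  have IH: "no_isolated (a # b # fill ?D [] b w)" by (rule Cons)
  show ?case
  proof (cases "a = b")
    case True
    then show ?thesis using IH by simp
  next
    case False
    obtain n where n: "M = Suc n" using assms by (cases M) auto
    have "no_isolated (a # replicate (Suc n) a @ b # fill ?D [] b w)"
      by (rule no_isolated_replicate[OF IH])
    then show ?thesis using False n by simp
  qed
qed simp

section \<open>Examples excluding all regular patterns\<close>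

text \<open>With one letter in excess, membership reduces to matching \<open>once \<pi>\<close>. The
  factor \<open>m\<close> has fixed length, so at least one of \<open>\<rho>1\<close> and
  \<open>\<rho>2\<close> yields only its letters, and the last two assumptions exclude these two
  cases.\<close>

lemma once_insert_notin_lang:
  assumes once: "once \<pi> = \<rho>1 @ map Ter m @ \<rho>2" and "length m' = Suc (length m)"
    and "\<And>s. matches \<rho>1 s \<Longrightarrow> letters \<rho>1 @ m' \<noteq> s @ m"
    and "\<And>s. matches \<rho>2 s \<Longrightarrow> m' @ letters \<rho>2 \<noteq> m @ s"
  shows "letters \<rho>1 @ m' @ letters \<rho>2 \<notin> lang \<pi>"
proof
  let ?v = "letters \<rho>1 @ m' @ letters \<rho>2"
  assume v: "?v \<in> lang \<pi>"
  have "letters \<pi> = letters (once \<pi>)" by simp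
  also have "\<dots> = letters \<rho>1 @ m @ letters \<rho>2" by (simp add: once)
  finally have "length ?v = Suc (length (letters \<pi>))" using assms(2) by simp
  with v have "matches (once \<pi>) ?v" by (rule lang_imp_matches_once)
  then obtain s1 s2 where s: "?v = s1 @ m @ s2" "matches \<rho>1 s1" "matches \<rho>2 s2"
    by (auto simp: once matches_append)
  have len: "length (letters \<rho>1) + Suc (length m) + length (letters \<rho>2) = length s1 + length m + length s2"
    using arg_cong[OF s(1), of length] assms(2) by simp
  show False
  proof (cases "length s1 \<le> length (letters \<rho>1)")
    case True
    then have "s1 = letters \<rho>1" using s(2) matches_same_length by blast
    then show False using s(1,3) assms(4)[of s2] by simp
  next
    case False
    then have "s2 = letters \<rho>2" using s(3) matches_same_length len by fastforce
    then show False using s(1,2) assms(3)[of s1] by simp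
  qed
qed

text \<open>The negative example \<open>v\<close> inserts one letter at a missing gap. A pattern that matches the letters
  of \<open>\<pi>\<close> but not \<open>v\<close> has the adjacent letters as a factor, and \<open>q\<close> destroys all occurrences of
  that factor.\<close>

lemma non_gapped_examples:
  fixes \<pi> :: "'a pattern"
  assumes \<pi>: "\<pi> \<in> simple_block_regular" and w: "letters \<pi> \<noteq> []" and two: "\<And>a::'a. \<exists>c. c \<noteq> a"
    and ng: "\<not> gapped (once \<pi>)"
  shows "\<exists>q v. q \<in> lang \<pi> \<and> v \<notin> lang \<pi> \<and>
    (\<forall>\<tau>. matches \<tau> (letters \<pi>) \<longrightarrow> matches \<tau> q \<longrightarrow> matches \<tau> v)"
proof -
  obtain a w where aw: "letters \<pi> = a # w" using w by (cases "letters \<pi>") auto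
  obtain M where "M \<ge> 1" and
    M: "\<And>s C t. pw M s @ a # fill (\<lambda>x y. pw M (C x y)) (pw M t) a w \<in> lang \<pi>"
    using simple_block_regular_fill[OF \<pi> aw] by blast
  then obtain n where n: "M = Suc n" by (cases M) auto
  have once: "letters (once \<pi>) = a # w" using aw by simp
  then have "once \<pi> \<noteq> []" by (metis letters.simps(1) list.distinct(1))
  have cases: "(\<exists>x \<sigma>. once \<pi> = Ter x # \<sigma>) \<or> (\<exists>x \<sigma>. once \<pi> = \<sigma> @ [Ter x]) \<or>
    (\<exists>\<sigma>1 \<sigma>2 x y. once \<pi> = \<sigma>1 @ [Ter x, Ter y] @ \<sigma>2 \<and> \<not> (x \<noteq> y \<and> UNIV = {x, y})) \<or>
    (\<exists>\<sigma>1 \<sigma>2 x y. once \<pi> = \<sigma>1 @ [Ter x, Ter y, Ter x] @ \<sigma>2 \<and> x \<noteq> y)"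
  proof (rule ccontr)
    assume no: "\<not> ?thesis"
    have "gapped (once \<pi>)"
      by (rule gappedI) (use \<open>once \<pi> \<noteq> []\<close> no in blast)+
    with ng show False ..
  qed
  have fin: ?thesis if "q \<in> lang \<pi>" "v \<notin> lang \<pi>"
    "\<And>\<tau>. matches \<tau> (a # w) \<Longrightarrow> matches \<tau> q \<Longrightarrow> matches \<tau> v" for q v
    using that unfolding aw by blast
  from cases consider
    (front) x \<sigma> where "once \<pi> = Ter x # \<sigma>"
  | (rear) x \<sigma> where "once \<pi> = \<sigma> @ [Ter x]"
  | (pair) \<sigma>1 \<sigma>2 x y where "once \<pi> = \<sigma>1 @ [Ter x, Ter y] @ \<sigma>2" "\<not> (x \<noteq> y \<and> UNIV = {x, y})"
  | (triple) \<sigma>1 \<sigma>2 x y where "once \<pi> = \<sigma>1 @ [Ter x, Ter y, Ter x] @ \<sigma>2" "x \<noteq> y"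
    by blast
  then show ?thesis
  proof cases
    case front
    then have x: "x = a" "letters \<sigma> = w" using once by auto
    obtain c where c: "c \<noteq> a" using two by blast
    have q: "replicate M c @ a # w \<in> lang \<pi>"
      using M[of "[c]" "\<lambda>x y. []" "[]"] by simp
    have "letters [] @ [c, a] @ letters \<sigma> \<notin> lang \<pi>"
      by (rule once_insert_notin_lang[where m = "[a]"]) (use front x c in auto)
    then have v: "c # a # w \<notin> lang \<pi>" using x by simp
    have "matches \<tau> (c # a # w)" if \<tau>: "matches \<tau> (a # w)" "matches \<tau> (replicate M c @ a # w)" for \<tau>
      using \<tau>(1)
    proof (rule matches_insert_front)
      assume "\<And>c. matches \<tau> (c @ a # w)"
      from this[of "[c]"] show ?thesis by simp
    next
      fix \<sigma> assume "\<tau> = Ter a # \<sigma>"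
      then show ?thesis using \<tau>(2) c n by auto
    qed
    then show ?thesis by (rule fin[OF q v])
  next
    case rear
    let ?u = "letters \<sigma>"
    have aw': "a # w = ?u @ [x]" using rear once by auto
    obtain c where c: "c \<noteq> x" using two by blast
    have "a # w @ replicate M c \<in> lang \<pi>"
      using M[of "[]" "\<lambda>x y. []" "[c]"] by simp
    then have q: "?u @ [x] @ replicate M c \<in> lang \<pi>" using aw' by (metis append_Cons append_assoc)
    have "letters \<sigma> @ [x, c] @ letters [] \<notin> lang \<pi>"
      by (rule once_insert_notin_lang[where m = "[x]"]) (use rear c in auto)
    then have v: "?u @ [x] @ [c] \<notin> lang \<pi>" by simp
    have "matches \<tau> (?u @ [x] @ [c])"
      if \<tau>: "matches \<tau> (?u @ [x])" "matches \<tau> (?u @ [x] @ replicate M c)" for \<tau>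
      using \<tau>(1)
    proof (rule matches_insert_back)
      assume "\<And>c. matches \<tau> (?u @ [x] @ c)"
      from this[of "[c]"] show ?thesis by simp
    next
      fix \<sigma>' assume "\<tau> = \<sigma>' @ [Ter x]"
      then obtain s where "?u @ [x] @ replicate M c = s @ [x]"
        using \<tau>(2) by (auto simp: matches_append)
      then have "last (?u @ [x] @ replicate M c) = x" by simp
      then show ?thesis using c n by (simp split: if_splits)
    qed
    then show ?thesis using fin[OF q v] unfolding aw' by blast
  next
    case pair
    let ?u1 = "letters \<sigma>1" and ?u2 = "letters \<sigma>2"
    have aw': "a # w = ?u1 @ [x] @ [y] @ ?u2" using pair once by auto
    \<comment> \<open>If \<open>x = y\<close>, any other letter will do; otherwise the alphabet has
      a third letter.\<close>
    obtain c where c: "c \<noteq> x" "c \<noteq> y" using two[of x] pair(2) by blast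
    \<comment> \<open>Every gap between \<open>x\<close> and \<open>y\<close> receives a power of
      \<open>c\<close>, so \<open>x y\<close> is not a factor of \<open>?q\<close>.\<close>
    let ?C = "\<lambda>x' y'. if x' = x \<and> y' = y then [c] else []"
    let ?q = "a # fill (\<lambda>x y. pw M (?C x y)) [] a w"
    have q: "?q \<in> lang \<pi>" using M[of "[]" ?C "[]"] by simp
    have "letters \<sigma>1 @ [x, c, y] @ letters \<sigma>2 \<notin> lang \<pi>"
      by (rule once_insert_notin_lang[where m = "[x, y]"]) (use pair c in auto)
    then have v: "?u1 @ [x] @ [c] @ [y] @ ?u2 \<notin> lang \<pi>" by simp
    let ?P = "\<lambda>s t. \<not> (s = x \<and> t = y)"
    have rep: "successively ?P (c # replicate k c @ [y])" for k
      using c by (induction k) auto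
    have succ: "successively ?P ?q"
      by (rule successively_fill) (use rep[of n] c in \<open>auto simp: n\<close>)
    have "matches \<tau> (?u1 @ [x] @ [c] @ [y] @ ?u2)"
      if \<tau>: "matches \<tau> (?u1 @ [x] @ [y] @ ?u2)" "matches \<tau> ?q" for \<tau>
      using \<tau>(1)
    proof (rule matches_insert)
      assume "\<And>c. matches \<tau> (?u1 @ [x] @ c @ [y] @ ?u2)"
      then show ?thesis by blast
    next
      fix \<tau>1 \<tau>2 assume "\<tau> = \<tau>1 @ [Ter x, Ter y] @ \<tau>2"
      then obtain z1 z2 where "?q = z1 @ [x, y] @ z2"
        using \<tau>(2) by (auto simp: matches_append)
      with succ have "successively ?P (z1 @ [x, y] @ z2)" by (simp only:)
      from successively_factor[OF this] show ?thesis by simp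
    qed
    then show ?thesis using fin[OF q v] unfolding aw' by blast
  next
    case triple
    let ?u1 = "letters \<sigma>1" and ?u2 = "letters \<sigma>2"
    have aw': "a # w = ?u1 @ [x] @ [y] @ x # ?u2" using triple once by auto
    \<comment> \<open>Letters are repeated before each change, so \<open>x y x\<close> is not a
      factor of \<open>?q\<close>; the negative example will double the \<open>y\<close>.\<close>
    let ?q = "a # fill (\<lambda>x y. pw M (if x = y then [] else [x])) [] a w"
    have q: "?q \<in> lang \<pi>" using M[of "[]" "\<lambda>x y. if x = y then [] else [x]" "[]"] by simp
    have "letters \<sigma>1 @ [x, y, y, x] @ letters \<sigma>2 \<notin> lang \<pi>"
      by (rule once_insert_notin_lang[where m = "[x, y, x]"]) (use triple in auto)
    then have v: "?u1 @ [x] @ [y] @ [y] @ x # ?u2 \<notin> lang \<pi>" by simp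
    have "no_isolated (a # ?q)" using \<open>M \<ge> 1\<close> by (rule no_isolated_fill)
    have "matches \<tau> (?u1 @ [x] @ [y] @ [y] @ x # ?u2)"
      if \<tau>: "matches \<tau> (?u1 @ [x] @ [y] @ x # ?u2)" "matches \<tau> ?q" for \<tau>
      using \<tau>(1)
    proof (rule matches_insert)
      assume "\<And>c. matches \<tau> (?u1 @ [x] @ c @ [y] @ x # ?u2)"
      then show ?thesis by blast
    next
      fix \<tau>1 \<tau>2 assume \<tau>12: "\<tau> = \<tau>1 @ [Ter x, Ter y] @ \<tau>2" "matches \<tau>1 ?u1" "matches \<tau>2 (x # ?u2)"
      \<comment> \<open>The second \<open>y\<close> may be inserted before or after the first one;
        both are blocked only if \<open>\<tau>\<close> contains \<open>x y x\<close>.\<close>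
      from \<tau>12(3) show ?thesis
      proof (rule matches_insert_front)
        assume "\<And>c. matches \<tau>2 (c @ x # ?u2)"
        from this[of "[y]"] show ?thesis using \<tau>12 by (auto simp: matches_append)
      next
        fix \<sigma> assume "\<tau>2 = Ter x # \<sigma>"
        then obtain z1 z2 where "?q = z1 @ [x, y, x] @ z2"
          using \<tau>(2) \<tau>12(1) by (auto simp: matches_append)
        then have "a # ?q = (a # z1) @ [x, y, x] @ z2" by (simp only: append_Cons)
        with \<open>no_isolated (a # ?q)\<close> have "no_isolated ((a # z1) @ [x, y, x] @ z2)" by (simp only:)
        from no_isolated_factor[OF this] show ?thesis using triple(2) by simp
      qed
    qed
    then show ?thesis using fin[OF q v] unfolding aw' by blast
  qed
qed

section \<open>Examples for shuffle ideals\<close>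

text \<open>A factor of \<open>\<tau>\<close> consisting of letters occurs in every word that
  \<open>\<tau>\<close> matches, and a letter at an end of \<open>\<tau>\<close> is the end letter
  of every such word. So what \<open>p\<close> and \<open>q\<close> do not share cannot occur in
  \<open>\<tau>\<close>.\<close>

lemma common_pattern_gapped:
  fixes p q :: "'a list"
  assumes \<tau>: "matches \<tau> p" "matches \<tau> q" and "p \<noteq> []" "q \<noteq> []" "hd p \<noteq> hd q" "last p \<noteq> last q"
    and pair: "\<And>x y s1 s2 t1 t2. \<lbrakk>p = s1 @ [x, y] @ s2; q = t1 @ [x, y] @ t2\<rbrakk> \<Longrightarrow> x \<noteq> y \<and> UNIV = {x, y}"
    and triple: "\<And>x y s1 s2 t1 t2. \<lbrakk>x \<noteq> y; p = s1 @ [x, y, x] @ s2; q = t1 @ [x, y, x] @ t2\<rbrakk> \<Longrightarrow> False"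
  shows "gapped \<tau>"
proof (rule gappedI)
  have factor: "\<exists>s1 s2. z = s1 @ l @ s2" if "\<tau> = \<sigma>1 @ map Ter l @ \<sigma>2" "matches \<tau> z" for \<sigma>1 \<sigma>2 l z
    using that by (auto simp: matches_append)
  show "\<tau> \<noteq> []" using \<tau> assms(3) by auto
  show "\<tau> \<noteq> Ter a # \<sigma>" for a \<sigma> using \<tau> assms(5) by auto
  show "\<tau> \<noteq> \<sigma> @ [Ter a]" for a \<sigma> using \<tau> assms(6) by (auto simp: matches_append)
  show "x \<noteq> y \<and> UNIV = {x, y}" if "\<tau> = \<sigma>1 @ [Ter x, Ter y] @ \<sigma>2" for \<sigma>1 \<sigma>2 x y
  proof -
    have t: "\<tau> = \<sigma>1 @ map Ter [x, y] @ \<sigma>2" using that by simp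
    obtain s1 s2 t1 t2 where "p = s1 @ [x, y] @ s2" "q = t1 @ [x, y] @ t2"
      using factor[OF t \<tau>(1)] factor[OF t \<tau>(2)] by blast
    then show ?thesis by (rule pair)
  qed
  show "\<tau> \<noteq> \<sigma>1 @ [Ter x, Ter y, Ter x] @ \<sigma>2" if "x \<noteq> y" for \<sigma>1 \<sigma>2 x y
  proof
    assume "\<tau> = \<sigma>1 @ [Ter x, Ter y, Ter x] @ \<sigma>2"
    then have t: "\<tau> = \<sigma>1 @ map Ter [x, y, x] @ \<sigma>2" by simp
    obtain s1 s2 t1 t2 where "p = s1 @ [x, y, x] @ s2" "q = t1 @ [x, y, x] @ t2"
      using factor[OF t \<tau>(1)] factor[OF t \<tau>(2)] by blast
    then show False by (rule triple[OF that])
  qed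
qed

text \<open>This is the part shared by the binary and the ternary construction. The fillings
  \<open>C\<close> and \<open>D\<close> give the two positive examples; \<open>d\<close> and
  \<open>d'\<close> make their ends differ.\<close>

lemma shuffle_ideal_examples_aux:
  fixes w :: "'a list"
  assumes gapped: "\<And>\<tau>. \<lbrakk>matches \<tau> (a # fill C [d'] a w); matches \<tau> (d # a # fill D [] a w)\<rbrakk> \<Longrightarrow> gapped \<tau>"
    and C: "\<And>x y. x \<notin> set (C x y)" "\<And>x y. y \<notin> set (C x y)" and D: "\<And>x y. y \<notin> set (D x y)"
    and CD: "\<And>x y E w. \<lbrakk>E \<noteq> []; subseq E (C x y); subseq (E @ y # w) (D x y @ y # fill D [] y w)\<rbrakk> \<Longrightarrow> False"
    and d: "d \<noteq> a" "d' \<noteq> last (a # w)"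
  shows "\<exists>p q v. subseq (a # w) p \<and> subseq (a # w) q \<and> \<not> subseq (a # w) v \<and>
    (\<forall>\<tau>. matches \<tau> p \<longrightarrow> matches \<tau> q \<longrightarrow> \<not> matches \<tau> v \<longrightarrow> (\<forall>z. matches \<tau> z \<longleftrightarrow> subseq (a # w) z))"
proof -
  let ?p = "a # fill C [d'] a w" and ?q = "d # a # fill D [] a w"
  define F where "F = {u. subseq u ?p \<and> \<not> subseq (a # w) u}"
  \<comment> \<open>The word \<open>v\<close> is to contain all subsequences of \<open>?p\<close>
    that avoid \<open>a # w\<close>; as these are finitely many, directedness provides it.\<close>
  have "F \<subseteq> set (subseqs ?p)" unfolding F_def set_subseqs_eq by blast
  then have "finite F" by (rule finite_subset) simp
  moreover have "\<not> subseq (a # w) u" if "u \<in> F" for u using that by (simp add: F_def)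
  ultimately obtain v where "\<forall>u \<in> F. subseq u v" and v2: "\<not> subseq (a # w) v"
    using avoiding_directed[of "a # w" F] by blast
  then have v1: "subseq u v" if "subseq u ?p" "\<not> subseq (a # w) u" for u
    using that unfolding F_def by blast
  have "subseq (a # w) z \<longleftrightarrow> matches \<tau> z"
    if \<tau>: "matches \<tau> ?p" "matches \<tau> ?q" "\<not> matches \<tau> v" for \<tau> z
  proof -
    have g: "gapped \<tau>" using gapped \<tau> by blast
    define u where "u = letters \<tau>"
    have u: "subseq u ?p" "subseq u ?q" "\<not> subseq u v"
      using \<tau> by (auto simp: u_def gapped_matches_iff[OF g])
    then have wu: "subseq (a # w) u" using v1 by blast
    then obtain y u1 where yu: "u = y # u1" by (cases u) auto
    have tight: "\<not> subseq (x # a # w) ?p" for x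
      by (rule fill_tight) (use C d in auto)
    have "y = a"
    proof (rule ccontr)
      assume "y \<noteq> a"
      then have "subseq (y # a # w) u" using wu yu by auto
      then show False using tight u(1) subseq_order.order_trans by blast
    qed
    \<comment> \<open>As \<open>d \<noteq> a\<close>, the first letter of \<open>u\<close> can only
      be matched behind \<open>d\<close> in \<open>?q\<close>.\<close>
    then have u1: "subseq w u1" "subseq u1 (fill C [d'] a w)" "subseq u1 (fill D [] a w)"
      using wu u(1,2) yu d(1) by auto
    have "u1 = w" by (rule fill_common_subseq[OF C D CD _ u1]) (use d in auto)
    then show ?thesis using yu \<open>y = a\<close> gapped_matches_iff[OF g] by (simp add: u_def)
  qed
  moreover have "subseq (a # w) ?p" "subseq (a # w) ?q"
    using subseq_fill by (auto intro: subseq_fill list_emb_Cons)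
  ultimately show ?thesis using v2 by blast
qed

text \<open>\<open>C\<close> separates equal neighbours, so \<open>p\<close> alternates;
  \<open>D\<close> repeats a letter before each change, so \<open>q\<close> has no factor
  \<open>x y x\<close> with \<open>x \<noteq> y\<close>. Common factors of length 2 are then of the
  kind that \<open>gapped\<close> tolerates.\<close>

lemma shuffle_ideal_examples_binary:
  fixes a :: 'a
  assumes "g \<noteq> h" and gh: "\<And>x::'a. x = g \<or> x = h"
  shows "\<exists>p q v. subseq (a # w) p \<and> subseq (a # w) q \<and> \<not> subseq (a # w) v \<and>
    (\<forall>\<tau>. matches \<tau> p \<longrightarrow> matches \<tau> q \<longrightarrow> \<not> matches \<tau> v \<longrightarrow> (\<forall>z. matches \<tau> z \<longleftrightarrow> subseq (a # w) z))"
proof -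
  define other where "other x = (if x = g then h else g)" for x
  have other: "other x \<noteq> x" for x using assms by (auto simp: other_def)
  define C where "C x y = (if x = y then [other x] else [])" for x y
  define D where "D x y = (if x = y then [] else [x])" for x y :: 'a
  let ?p = "a # fill C [other (last (a # w))] a w" and ?q = "other a # a # fill D [] a w"
  have C_succ: "successively (\<noteq>) ?p"
  proof (rule successively_fill)
    show "successively (\<noteq>) (x # C x y @ [y])" for x y
      using other[of x] by (auto simp: C_def)
    show "successively (\<noteq>) [last (a # w), other (last (a # w))]"
      using other[of "last (a # w)"] by auto
  qed
  have "D = (\<lambda>x y. pw 1 (if x = y then [] else [x]))" by (auto simp: D_def fun_eq_iff)
  then have D_iso: "no_isolated ?q" using no_isolated_fill[of 1 "other a" a w] by simp
  have D_last: "last (x # fill D [] x w) = last (x # w)" for x w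
    by (induction w arbitrary: x) auto
  have C_last: "last (fill C [c] x w) = c \<and> fill C [c] x w \<noteq> []" for c x w
    by (induction w arbitrary: x) auto
  \<comment> \<open>Here \<open>fill_tight\<close> is not applicable, since \<open>D\<close> repeats
    the left letter of a gap. The condition \<open>x \<noteq> y\<close> replaces it: neither copy of
    \<open>y\<close> can serve as \<open>x\<close>.\<close>
  have D_tight: "\<not> subseq (x # y # w) (y # fill D [] y w)" if "x \<noteq> y" for x y w
    using that
  proof (induction w arbitrary: x y)
    case (Cons c w)
    show ?case
    proof
      assume "subseq (x # y # c # w) (y # fill D [] y (c # w))"
      then have s: "subseq (x # y # c # w) (D y c @ c # fill D [] c w)"
        using Cons.prems by simp
      show False
      proof (cases "y = c")
        case True
        then have "subseq (x # c # c # w) (c # fill D [] c w)" using s by (simp add: D_def)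
        then have "subseq (x # c # w) (c # fill D [] c w)"
          by (rule subseq_order.order_trans[rotated]) auto
        then show False using Cons.IH Cons.prems True by blast
      next
        case False
        then have "subseq (x # y # c # w) (c # fill D [] c w)"
          using s Cons.prems by (simp add: D_def)
        then have "subseq (y # c # w) (c # fill D [] c w)" by (rule subseq_Cons')
        then show False using Cons.IH False by blast
      qed
    qed
  qed simp
  show ?thesis
  proof (rule shuffle_ideal_examples_aux)
    show "x \<notin> set (C x y)" "y \<notin> set (C x y)" "y \<notin> set (D x y)" for x y
      using other[of x] by (auto simp: C_def D_def)
    show "other a \<noteq> a" "other (last (a # w)) \<noteq> last (a # w)" by (rule other)+
    show False if "E \<noteq> []" "subseq E (C x y)" "subseq (E @ y # w) (D x y @ y # fill D [] y w)" for x y E w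
    proof (cases "x = y")
      case True
      have "E = [other x]" using that(1,2) True
        by (cases E) (auto simp: C_def split: if_splits)
      then show False using that(3) D_tight[of "other x" y] True other[of x] by (simp add: D_def)
    next
      case False
      then show False using that(1,2) by (simp add: C_def)
    qed
    show "gapped \<tau>" if \<tau>: "matches \<tau> ?p" "matches \<tau> ?q" for \<tau>
      using \<tau>
    proof (rule common_pattern_gapped)
      show "hd ?p \<noteq> hd ?q" using other[of a] by auto
      have "last ?p = other (last (a # w))" using C_last by simp
      moreover have "last ?q = last (a # w)" using D_last[of a w] by simp
      ultimately show "last ?p \<noteq> last ?q" using other by metis
      show "x \<noteq> y \<and> UNIV = {x, y}" if "?p = s1 @ [x, y] @ s2" for x y s1 s2
      proof -
        have "successively (\<noteq>) (s1 @ [x, y] @ s2)" using C_succ unfolding that .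
        then have "x \<noteq> y" by (rule successively_factor)
        moreover have "z \<in> {x, y}" for z
          using gh[of x] gh[of y] gh[of z] \<open>x \<noteq> y\<close> by auto
        ultimately show ?thesis by blast
      qed
      show False if "x \<noteq> y" "?q = t1 @ [x, y, x] @ t2" for x y t1 t2
      proof -
        have "no_isolated (t1 @ [x, y, x] @ t2)" using D_iso unfolding that(2) .
        from no_isolated_factor[OF this] show False using that(1) by simp
      qed
    qed auto
  qed
qed

text \<open>With three letters \<open>e\<close>, \<open>g\<close>, \<open>h\<close>, the pairs of letters are split into a relation \<open>R\<close>,
  generated by the cycle from \<open>e\<close> over \<open>h\<close> and \<open>g\<close> back to \<open>e\<close> (all letters other than \<open>g\<close> and \<open>h\<close>
  being treated alike), and its complement, which contains the reversed cycle. Any two letters are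
  connected by a path in \<open>R\<close> and by a path in the complement, one of them being a single step.\<close>

lemma shuffle_ideal_examples_ternary:
  fixes a g h e :: 'a
  assumes dist: "g \<noteq> h" "e \<noteq> g" "e \<noteq> h"
  shows "\<exists>p q v. subseq (a # w) p \<and> subseq (a # w) q \<and> \<not> subseq (a # w) v \<and>
    (\<forall>\<tau>. matches \<tau> p \<longrightarrow> matches \<tau> q \<longrightarrow> \<not> matches \<tau> v \<longrightarrow> (\<forall>z. matches \<tau> z \<longleftrightarrow> subseq (a # w) z))"
proof -
  define R where "R x y \<longleftrightarrow> x = y \<or> (if x = h then y = g else if x = g then y \<noteq> h else y \<noteq> g)" for x y :: 'a
  define C where "C x y = (if R x y then [] else if x = h then [g] else if x = g then [e] else [h])" for x y
  \<comment> \<open>As \<open>R\<close> is reflexive, a path in the complement between two letters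
    of the same kind has to run around the whole cycle and needs two inner letters.\<close>
  define D where "D x y = (if \<not> R x y then [] else
    if x = h then (if y = h then [e, g] else [e]) else
    if x = g then (if y = g then [h, e] else [h]) else
    (if y = h then [g] else [g, h]))" for x y
  \<comment> \<open>Both \<open>d\<close> and \<open>d'\<close> are successors on the cycle of
    \<open>R\<close>: the step to \<open>d'\<close> lies in \<open>R\<close>, the step back from
    \<open>d\<close> to \<open>a\<close> in its complement.\<close>
  define d where "d = (if a = h then g else if a = g then e else h)"
  define d' where "d' = (if last (a # w) = h then g else if last (a # w) = g then e else h)"
  let ?p = "a # fill C [d'] a w" and ?q = "d # a # fill D [] a w"
  have C: "x \<notin> set (C x y)" "y \<notin> set (C x y)" for x y
    using dist by (auto simp: C_def R_def)
  have D: "x \<notin> set (D x y)" "y \<notin> set (D x y)" for x y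
    using dist by (auto simp: D_def R_def)
  have C_succ: "successively R ?p"
  proof (rule successively_fill)
    show "successively R (x # C x y @ [y])" for x y
      using dist by (auto simp: C_def R_def)
    show "successively R [last (a # w), d']"
      using dist by (auto simp: d'_def R_def)
  qed
  have "successively (\<lambda>x y. \<not> R x y) (a # fill D [] a w)"
  proof (rule successively_fill)
    show "successively (\<lambda>x y. \<not> R x y) (x # D x y @ [y])" for x y
      using dist by (auto simp: D_def R_def)
  qed simp
  moreover have "\<not> R d a" using dist by (auto simp: d_def R_def)
  ultimately have D_succ: "successively (\<lambda>x y. \<not> R x y) ?q" by simp
  \<comment> \<open>In each gap at most one of the two fillings is nonempty.\<close>
  have disjoint: "set (C x y) \<inter> set (D x y) = {}" for x y
    by (auto simp: C_def D_def)
  have D_last: "last (x # fill D [] x w) = last (x # w)" for x w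
    by (induction w arbitrary: x) auto
  have C_last: "last (fill C [c] x w) = c \<and> fill C [c] x w \<noteq> []" for c x w
    by (induction w arbitrary: x) auto
  have d: "d \<noteq> a" using dist by (auto simp: d_def)
  have d': "d' \<noteq> last (a # w)" using dist by (auto simp: d'_def)
  show ?thesis
  proof (rule shuffle_ideal_examples_aux[OF _ C D(2) _ d d'])
    show False if "E \<noteq> []" "subseq E (C x y)" "subseq (E @ y # w) (D x y @ y # fill D [] y w)" for x y E w
    proof -
      have "subseq E (D x y)" by (rule fill_peel[OF D _ that(3)]) simp_all
      then have "set E \<subseteq> {}" using subseq_imp_subset that(2) disjoint[of x y] by blast
      then show False using that(1) by simp
    qed
    show "gapped \<tau>" if \<tau>: "matches \<tau> ?p" "matches \<tau> ?q" for \<tau>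
      using \<tau>
    proof (rule common_pattern_gapped)
      have no_pair: False if "?p = s1 @ [x, y] @ s2" "?q = t1 @ [x, y] @ t2" for x y s1 s2 t1 t2
      proof -
        have "R x y" using C_succ unfolding that(1) by (rule successively_factor)
        moreover have "\<not> R x y" using D_succ unfolding that(2) by (rule successively_factor)
        ultimately show False by simp
      qed
      show "hd ?p \<noteq> hd ?q" using d by simp
      have "last ?p = d'" using C_last by simp
      moreover have "last ?q = last (a # w)" using D_last[of a w] by simp
      ultimately show "last ?p \<noteq> last ?q" using d' by metis
      show "x \<noteq> y \<and> UNIV = {x, y}" if "?p = s1 @ [x, y] @ s2" "?q = t1 @ [x, y] @ t2" for x y s1 s2 t1 t2
        using no_pair[OF that] by blast
      show False if "?p = s1 @ [x, y, x] @ s2" "?q = t1 @ [x, y, x] @ t2" for x y s1 s2 t1 t2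
        by (rule no_pair[of s1 x y "x # s2" t1 "x # t2"]) (simp_all only: that append_Cons append_Nil)
    qed auto
  qed
qed

lemma shuffle_ideal_examples:
  fixes w :: "'a list"
  assumes "w \<noteq> []" "\<And>a::'a. \<exists>c. c \<noteq> a"
  shows "\<exists>p q v. subseq w p \<and> subseq w q \<and> \<not> subseq w v \<and>
    (\<forall>\<tau>. matches \<tau> p \<longrightarrow> matches \<tau> q \<longrightarrow> \<not> matches \<tau> v \<longrightarrow> (\<forall>z. matches \<tau> z \<longleftrightarrow> subseq w z))"
proof -
  obtain a w' where w: "w = a # w'" using assms(1) by (cases w) auto
  obtain g h :: 'a where gh: "g \<noteq> h" using assms(2) by blast
  show ?thesis
  proof (cases "\<exists>e. e \<noteq> g \<and> e \<noteq> h")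
    case True
    then obtain e where "e \<noteq> g" "e \<noteq> h" by blast
    from shuffle_ideal_examples_ternary[OF gh this] show ?thesis unfolding w .
  next
    case False
    then have "x = g \<or> x = h" for x by blast
    from shuffle_ideal_examples_binary[OF gh this] show ?thesis unfolding w .
  qed
qed

section \<open>Teaching dimension\<close>

lemma TD_le_3:
  assumes "p \<in> lang \<pi>" "q \<in> lang \<pi>" "v \<notin> lang \<pi>"
    and "\<And>\<tau>. \<lbrakk>\<tau> \<in> regular_patterns; matches \<tau> p; matches \<tau> q; \<not> matches \<tau> v\<rbrakk> \<Longrightarrow> lang \<tau> = lang \<pi>"
  shows "TD \<pi> regular_patterns \<le> 3"
proof -
  let ?T = "{(p, True), (q, True), (v, False)}"
  have "teaching_set ?T \<pi> regular_patterns"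
    using assms unfolding teaching_set_def consistent_def by (auto simp: lang_regular)
  then have "TD \<pi> regular_patterns \<le> enat (card ?T)"
    unfolding TD_def by (intro INF_lower) simp
  \<comment> \<open>The examples \<open>p\<close> and \<open>q\<close> may coincide, so only an
    upper bound on the cardinality is available.\<close>
  also have "enat (card ?T) \<le> enat 3"
    using card_insert_le_m1[of 3 "{(q, True), (v, False)}"] card_insert_le_m1[of 2 "{(v, False)}"]
    by simp
  finally show ?thesis by (simp add: numeral_eq_enat)
qed

section \<open>Degenerate cases of the upper bound\<close>

text \<open>A regular pattern matching the empty word starts with a variable that can absorb any
  word. So either \<open>[]\<close> alone teaches the universal language, or \<open>[]\<close> and a
  word outside \<open>lang \<pi>\<close> exclude all regular patterns.\<close>

lemma TD_le_3_no_letters: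
  fixes \<pi> :: "'a pattern"
  assumes "letters \<pi> = []"
  shows "TD \<pi> regular_patterns \<le> 3"
proof -
  have univ: "lang \<tau> = UNIV" if reg: "\<tau> \<in> regular_patterns" and nil: "matches \<tau> []" for \<tau> :: "'a pattern"
  proof -
    obtain s \<sigma> where \<tau>: "\<tau> = s # \<sigma>"
      using reg by (cases \<tau>) (auto simp: regular_patterns_def is_pattern_def)
    then obtain x where "s = Var x" using nil by (cases s) auto
    then have "matches \<tau> z" for z using nil \<tau> by auto
    then show ?thesis using lang_regular[OF reg] by auto
  qed
  have nil: "[] \<in> lang \<pi>" using letters_in_lang[of \<pi>] assms by simp
  show ?thesis
  proof (cases "lang \<pi> = UNIV")
    case True
    have "teaching_set {([], True)} \<pi> regular_patterns"
      using univ True unfolding teaching_set_def consistent_def by (auto simp: lang_regular)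
    then have "TD \<pi> regular_patterns \<le> enat (card {([] :: 'a list, True)})"
      unfolding TD_def by (intro INF_lower) simp
    also have "\<dots> \<le> 3" by (simp add: numeral_eq_enat one_enat_def)
    finally show ?thesis .
  next
    case False
    then obtain v where v: "v \<notin> lang \<pi>" by blast
    show ?thesis
    proof (rule TD_le_3[OF nil nil v])
      fix \<tau> :: "'a pattern"
      assume \<tau>: "\<tau> \<in> regular_patterns" "matches \<tau> []" "\<not> matches \<tau> v"
      then have "v \<in> lang \<tau>" using univ by simp
      then show "lang \<tau> = lang \<pi>" using \<tau> lang_regular by blast
    qed
  qed
qed

lemma matches_no_vars: "var_list \<tau> = [] \<Longrightarrow> matches \<tau> z \<longleftrightarrow> z = letters \<tau>"
  by (induction \<tau> arbitrary: z rule: letters.induct) auto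

text \<open>Over one letter a word is determined by its length, and a variable absorbs the
  surplus.\<close>

lemma matches_unary:
  fixes a :: 'a and \<tau> :: "'a pattern"
  assumes "\<And>c::'a. c = a"
    and "var_list \<tau> \<noteq> []" "length (letters \<tau>) \<le> length z"
  shows "matches \<tau> z"
  using assms(2,3)
proof (induction \<tau> arbitrary: z rule: letters.induct)
  case (2 x \<tau>)
  let ?k = "length z - length (letters \<tau>)"
  have "drop ?k z = letters \<tau>"
  proof (rule nth_equalityI)
    show "length (drop ?k z) = length (letters \<tau>)" using "2.prems" by simp
    show "drop ?k z ! i = letters \<tau> ! i" for i
      by (rule trans[OF assms(1) sym[OF assms(1)]])
  qed
  then have "z = take ?k z @ letters \<tau>" by (metis append_take_drop_id)
  then show ?case using matches_letters matches.simps(2) by blast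
next
  case (3 b \<tau>)
  then obtain c z' where z: "z = c # z'" by (cases z) auto
  then have "matches \<tau> z'" using 3 by simp
  moreover have "c = b" by (rule trans[OF assms(1) sym[OF assms(1)]])
  ultimately show ?case using z by simp
qed simp

text \<open>If \<open>once \<pi>\<close> has a variable, the language is given by its minimal
  length, which \<open>tl ?w\<close> bounds from below. Otherwise \<open>a # ?w\<close> is outside
  the language, but every pattern matching \<open>?w\<close> and a longer word has a variable and
  matches it.\<close>

lemma TD_le_3_unary:
  fixes \<pi> :: "'a pattern" and a :: 'a
  assumes \<pi>: "\<pi> \<in> simple_block_regular" and w: "letters \<pi> \<noteq> []" and unary: "\<And>c::'a. c = a"
  shows "TD \<pi> regular_patterns \<le> 3"
proof -
  let ?w = "letters \<pi>"
  have has_var: "var_list \<tau> \<noteq> []" if "matches \<tau> ?w" "matches \<tau> z" "z \<noteq> ?w" for \<tau> z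
    using that matches_no_vars by metis
  show ?thesis
  proof (cases "var_list (once \<pi>) = []")
    case True
    obtain b w' where aw: "?w = b # w'" using w by (cases ?w) auto
    obtain M where "M \<ge> 1" and
      M: "\<And>s C t. pw M s @ b # fill (\<lambda>x y. pw M (C x y)) (pw M t) b w' \<in> lang \<pi>"
      using simple_block_regular_fill[OF \<pi> aw] by blast
    have q: "replicate M a @ ?w \<in> lang \<pi>" using M[of "[a]" "\<lambda>x y. []" "[]"] aw by simp
    have v: "a # ?w \<notin> lang \<pi>"
      using lang_imp_matches_once[of "a # ?w" \<pi>] matches_no_vars[OF True, of "a # ?w"] by auto
    show ?thesis
    proof (rule TD_le_3[OF letters_in_lang q v])
      fix \<tau> assume \<tau>: "matches \<tau> ?w" "matches \<tau> (replicate M a @ ?w)" "\<not> matches \<tau> (a # ?w)"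
      have "var_list \<tau> \<noteq> []" using has_var[OF \<tau>(1,2)] \<open>M \<ge> 1\<close> by simp
      then have "matches \<tau> (a # ?w)"
        using matches_unary[OF unary] matches_length[OF \<tau>(1)] by fastforce
      with \<tau> show "lang \<tau> = lang \<pi>" by simp
    qed
  next
    case False
    have lang: "z \<in> lang \<pi> \<longleftrightarrow> length ?w \<le> length z" for z
      using matches_unary[OF unary False, of z] matches_once_imp_lang[of \<pi> z]
        lang_imp_matches[of z \<pi>] matches_length[of \<pi> z] by auto
    show ?thesis
    proof (rule TD_le_3[of ?w _ "a # ?w" "tl ?w"])
      show "?w \<in> lang \<pi>" "a # ?w \<in> lang \<pi>" by (simp_all add: lang)
      show "tl ?w \<notin> lang \<pi>" unfolding lang using w by (cases ?w) auto
      fix \<tau> assume \<tau>: "\<tau> \<in> regular_patterns" "matches \<tau> ?w" "matches \<tau> (a # ?w)" "\<not> matches \<tau> (tl ?w)"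
      have var: "var_list \<tau> \<noteq> []" using has_var[OF \<tau>(2,3)] by simp
      have m: "matches \<tau> z \<longleftrightarrow> length (letters \<tau>) \<le> length z" for z
        using matches_unary[OF unary var] matches_length by blast
      have "length (letters \<tau>) = length ?w" using \<tau>(2,4) m by auto
      then show "lang \<tau> = lang \<pi>" using m lang lang_regular[OF \<tau>(1)] by auto
    qed
  qed
qed

lemma TD_simple_block_regular_le:
  fixes \<pi> :: "'a pattern"
  assumes \<pi>: "\<pi> \<in> simple_block_regular"
  shows "TD \<pi> regular_patterns \<le> 3"
proof -
  let ?w = "letters \<pi>"
  consider "?w = []" | a :: 'a where "?w \<noteq> []" "\<And>c. c = a" | "?w \<noteq> []" "\<And>a::'a. \<exists>c. c \<noteq> a"
    by metis
  then show ?thesis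
  proof cases
    case 1
    then show ?thesis by (rule TD_le_3_no_letters)
  next
    case 2
    then show ?thesis by (rule TD_le_3_unary[OF \<pi>])
  next
    case 3
    show ?thesis
    proof (cases "gapped (once \<pi>)")
      case True
      have lang: "lang \<pi> = {z. subseq ?w z}"
        using gapped_matches[OF True] matches_once_imp_lang[of \<pi>]
          lang_imp_matches[of _ \<pi>] matches_imp_subseq[of \<pi>] by auto
      obtain p q v where "subseq ?w p" "subseq ?w q" "\<not> subseq ?w v" and
        "\<forall>\<tau>. matches \<tau> p \<longrightarrow> matches \<tau> q \<longrightarrow> \<not> matches \<tau> v \<longrightarrow> (\<forall>z. matches \<tau> z \<longleftrightarrow> subseq ?w z)"
        using shuffle_ideal_examples[OF 3] by blast
      then show ?thesis by (intro TD_le_3[of p _ q v]) (auto simp: lang lang_regular)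
    next
      case False
      obtain q v where "q \<in> lang \<pi>" "v \<notin> lang \<pi>"
        "\<forall>\<tau>. matches \<tau> ?w \<longrightarrow> matches \<tau> q \<longrightarrow> matches \<tau> v"
        using non_gapped_examples[OF \<pi> 3 False] by blast
      then show ?thesis by (intro TD_le_3[of ?w _ q v]) (auto simp: letters_in_lang)
    qed
  qed
qed

section \<open>Lower bound\<close>

lemma lang_map_Ter: "lang (map Ter s) = {s}"
  using letters_in_lang[of "map Ter s"] lang_imp_matches[of _ "map Ter s"] by auto

lemma TD_Var_Ter_Var_ge:
  fixes a :: 'a
  shows "3 \<le> TD [Var 0, Ter a, Var 1] regular_patterns"
proof -
  let ?\<pi> = "[Var 0, Ter a, Var 1]"
  have reg: "?\<pi> \<in> regular_patterns" by (simp add: regular_patterns_def is_pattern_def)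
  have lang: "lang ?\<pi> = {z. a \<in> set z}"
    using lang_regular[OF reg] by (auto simp: in_set_conv_decomp)
  have "3 \<le> card T" if fin: "finite T" and T: "teaching_set T ?\<pi> regular_patterns" for T
  proof -
    have cons: "(w, b) \<in> T \<Longrightarrow> w \<in> lang ?\<pi> \<longleftrightarrow> b" for w b
      using T unfolding teaching_set_def consistent_def by auto
    have teach: "lang \<tau> = lang ?\<pi>" if "\<tau> \<in> regular_patterns" "consistent \<tau> T" for \<tau>
      using T that unfolding teaching_set_def by blast
    have neg: "\<exists>v. (v, False) \<in> T"
    proof (rule ccontr)
      assume no: "\<not> ?thesis"
      let ?\<tau> = "[Var 0] :: 'a pattern"
      have reg0: "?\<tau> \<in> regular_patterns" by (simp add: regular_patterns_def is_pattern_def)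
      have univ: "lang ?\<tau> = UNIV" using lang_regular[OF reg0] by auto
      have "consistent ?\<tau> T"
        unfolding consistent_def univ using no by (auto intro: ccontr)
      from teach[OF reg0 this] have "lang ?\<pi> = UNIV" using univ by simp
      then have "[] \<in> {z. a \<in> set z}" unfolding lang by blast
      then show False by simp
    qed
    \<comment> \<open>If no positive example differs from \<open>s\<close>, the constant pattern
      \<open>map Ter s\<close> is consistent with \<open>T\<close>.\<close>
    have pos: "\<exists>w \<noteq> s. (w, True) \<in> T" if s: "s \<in> lang ?\<pi>" for s
    proof (rule ccontr)
      assume no: "\<not> ?thesis"
      have "s \<noteq> []" using s lang by auto
      moreover have "var_list (map Ter s) = []" by (induction s) auto
      ultimately have regs: "map Ter s \<in> regular_patterns"
        by (simp add: regular_patterns_def is_pattern_def)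
      have "(w = s) = b" if "(w, b) \<in> T" for w b
        using cons[OF that] s no that by (cases b) auto
      then have "consistent (map Ter s) T"
        unfolding consistent_def lang_map_Ter by auto
      from teach[OF regs this] have "lang ?\<pi> = {s}" by (simp add: lang_map_Ter)
      moreover have "[a] \<in> lang ?\<pi>" "[a, a] \<in> lang ?\<pi>" unfolding lang by simp_all
      ultimately show False by (metis singletonD list.distinct(1) list.inject)
    qed
    obtain v where v: "(v, False) \<in> T" using neg by blast
    \<comment> \<open>The word \<open>[a]\<close> need not be an example itself; it only serves to
      obtain a first positive one.\<close>
    obtain w1 where w1: "(w1, True) \<in> T" using pos[of "[a]"] unfolding lang by auto
    then obtain w2 where w2: "w2 \<noteq> w1" "(w2, True) \<in> T" using pos[of w1] cons by blast
    have "card {(v, False), (w1, True), (w2, True)} \<le> card T"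
      using v w1 w2 fin by (intro card_mono) auto
    then show ?thesis using w2 by simp
  qed
  then show ?thesis unfolding TD_def
    by (intro INF_greatest) (auto simp: numeral_eq_enat)
qed

theorem mainTheorem3:
  shows "TD_class (simple_block_regular :: ('a::countable) pattern set) regular_patterns = 3"
proof (rule antisym)
  show "TD_class (simple_block_regular :: 'a pattern set) regular_patterns \<le> 3"
    unfolding TD_class_def by (intro SUP_least TD_simple_block_regular_le)
  let ?\<pi> = "[Var 0, Ter undefined, Var 1] :: 'a pattern"
  have "?\<pi> \<in> simple_block_regular"
    unfolding simple_block_regular_def mem_Collect_eq
    by (rule exI[of _ "[[0], [1]]"], rule exI[of _ "[undefined]"])
      (auto simp: less_Suc_eq)
  then have "TD ?\<pi> regular_patterns \<le> TD_class (simple_block_regular :: 'a pattern set) regular_patterns"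
    unfolding TD_class_def by (rule SUP_upper)
  then show "3 \<le> TD_class (simple_block_regular :: 'a pattern set) regular_patterns"
    by (rule order_trans[OF TD_Var_Ter_Var_ge])
qed

end
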